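(* The set of chemical graphs that are extremal for the topological index Sigma is exactly $F_6\cup F_7$.
   Context: All graphs are finite, simple and undirected. A chemical graph is a connected graph of order (number of vertices) $n\ge 7$, size (number of edges) $m\le \frac{3n-3}{2}$ and maximum degree at most $3$. For such a graph, $x_{ij}$ ($i\le j$) denotes the number of $(i,j)$-edges, i.e. edges whose endpoints have degrees $i$ and $j$ (necessarily $x_{11}=0$). A degree-based topological index is a function of the form $f(G)=c_{12}x_{12}+c_{13}x_{13}+c_{22}x_{22}+c_{23}x_{23}+c_{33}x_{33}$ with real coefficients $c_{ij}$. The Sigma index is the one with $c_{ij}=(i-j)^2$. A chemical graph $G$ is extremal for $f$ if it maximizes $f$ or minimizes $f$ over all chemical graphs of the same order and size as $G$. $F_6$ is the set of chemical graphs (of order $n$ and size $m$) with $(x_{12},x_{13},x_{22},x_{23},x_{33})=(0,a,0,6n-4m-4a,5m-6n+3a)$, where $a$ is any integer such that $\max\{0,\lceil\frac{6n-5m}{3}\rceil\}\le a\le\lfloor\frac{3n-2m}{2}\rfloor$. $F_7$ is the set of chemical graphs (of order $n$ and size $m$) with $(x_{12},x_{13},x_{22},x_{23},x_{33})$ equal to - $(2,0,m-2,0,0)$ if $m=n-1$; - $(0,0,m,0,0)$ if $m=n$; - $(0,0,m-5,4,1)$ or $(1,0,m-7,3,3)$ or (only when $n\ge 8$) $(2,0,m-9,2,5)$ if $m=n+1$; - $(0,0,3n-2m-1,2,3m-3n-1)$ or $(1,0,3n-2m-3,1,3m-3n+1)$ if $n+1<m\le\frac{3n-3}{2}$. *)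

theory Defs
  imports Complex_Main
begin

record 'a ugraph =
  verts :: "'a set"
  edges :: "'a set set"

definition simple_graph :: "'a ugraph \<Rightarrow> bool" where
  "simple_graph G \<longleftrightarrow>
     finite (verts G) \<and> (\<forall>e\<in>edges G. e \<subseteq> verts G \<and> card e = 2)"

definition graph_order :: "'a ugraph \<Rightarrow> nat" where
  "graph_order G = card (verts G)"

definition graph_size :: "'a ugraph \<Rightarrow> nat" where
  "graph_size G = card (edges G)"

definition vertex_degree :: "'a ugraph \<Rightarrow> 'a \<Rightarrow> nat" where
  "vertex_degree G v = card {e \<in> edges G. v \<in> e}"

definition adj_rel :: "'a ugraph \<Rightarrow> ('a \<times> 'a) set" where
  "adj_rel G = {(u, v). {u, v} \<in> edges G}"

definition graph_connected :: "'a ugraph \<Rightarrow> bool" where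
  "graph_connected G \<longleftrightarrow>
     verts G \<noteq> {} \<and> (\<forall>u\<in>verts G. \<forall>v\<in>verts G. (u, v) \<in> (adj_rel G)\<^sup>*)"

definition chemical_graph :: "'a ugraph \<Rightarrow> bool" where
  "chemical_graph G \<longleftrightarrow>
     simple_graph G \<and> graph_connected G \<and> graph_order G \<ge> 7 \<and>
     real (graph_size G) \<le> (3 * real (graph_order G) - 3) / 2 \<and>
     (\<forall>v\<in>verts G. vertex_degree G v \<le> 3)"

text \<open>The number of \<open>(i,j)\<close>-edges; it is symmetric in \<open>i\<close> and \<open>j\<close> because
  \<open>{u, v}\<close> is unordered.\<close>

definition num_edges :: "'a ugraph \<Rightarrow> nat \<Rightarrow> nat \<Rightarrow> nat" where
  "num_edges G i j =
     card {e \<in> edges G. \<exists>u v. e = {u, v} \<and> vertex_degree G u = i \<and> vertex_degree G v = j}"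

text \<open>The coefficient \<open>c i j\<close> is only used for
  \<open>(i,j) = (1,2), (1,3), (2,2), (2,3), (3,3)\<close>.\<close>

definition degree_based_index :: "(nat \<Rightarrow> nat \<Rightarrow> real) \<Rightarrow> 'a ugraph \<Rightarrow> real" where
  "degree_based_index c G =
     c 1 2 * real (num_edges G 1 2) + c 1 3 * real (num_edges G 1 3) +
     c 2 2 * real (num_edges G 2 2) + c 2 3 * real (num_edges G 2 3) +
     c 3 3 * real (num_edges G 3 3)"

definition Sigma_index :: "'a ugraph \<Rightarrow> real" where
  "Sigma_index = degree_based_index (\<lambda>i j. (real i - real j)\<^sup>2)"

text \<open>The competitors \<open>H\<close> range over graphs on the same vertex type as \<open>G\<close>. This is no
  restriction: since \<open>G\<close> itself has this type, so has an isomorphic copy of every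
  graph of the same order.\<close>

definition extremal :: "('a ugraph \<Rightarrow> real) \<Rightarrow> 'a ugraph \<Rightarrow> bool" where
  "extremal f G \<longleftrightarrow> chemical_graph G \<and>
     ((\<forall>H. chemical_graph H \<and> graph_order H = graph_order G \<and> graph_size H = graph_size G \<longrightarrow> f H \<le> f G) \<or>
      (\<forall>H. chemical_graph H \<and> graph_order H = graph_order G \<and> graph_size H = graph_size G \<longrightarrow> f G \<le> f H))"

text \<open>\<open>(x\<^sub>1\<^sub>2, x\<^sub>1\<^sub>3, x\<^sub>2\<^sub>2, x\<^sub>2\<^sub>3, x\<^sub>3\<^sub>3)\<close> as integers, so that the subtractions in the
  families below do not truncate.\<close>

definition edge_vector :: "'a ugraph \<Rightarrow> int \<times> int \<times> int \<times> int \<times> int" where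
  "edge_vector G =
     (int (num_edges G 1 2), int (num_edges G 1 3), int (num_edges G 2 2),
      int (num_edges G 2 3), int (num_edges G 3 3))"

definition F6 :: "'a ugraph set" where
  "F6 = {G. chemical_graph G \<and>
     (let n = int (graph_order G); m = int (graph_size G) in
      \<exists>a::int.
        max 0 \<lceil>real_of_int (6 * n - 5 * m) / 3\<rceil> \<le> a \<and>
        a \<le> \<lfloor>real_of_int (3 * n - 2 * m) / 2\<rfloor> \<and>
        edge_vector G = (0, a, 0, 6 * n - 4 * m - 4 * a, 5 * m - 6 * n + 3 * a))}"

definition F7 :: "'a ugraph set" where
  "F7 = {G. chemical_graph G \<and>
     (let n = int (graph_order G); m = int (graph_size G); x = edge_vector G in
      (m = n - 1 \<and> x = (2, 0, m - 2, 0, 0)) \<or>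
      (m = n \<and> x = (0, 0, m, 0, 0)) \<or>
      (m = n + 1 \<and>
        (x = (0, 0, m - 5, 4, 1) \<or>
         x = (1, 0, m - 7, 3, 3) \<or>
         (n \<ge> 8 \<and> x = (2, 0, m - 9, 2, 5)))) \<or>
      (n + 1 < m \<and> real_of_int m \<le> real_of_int (3 * n - 3) / 2 \<and>
        (x = (0, 0, 3 * n - 2 * m - 1, 2, 3 * m - 3 * n - 1) \<or>
         x = (1, 0, 3 * n - 2 * m - 3, 1, 3 * m - 3 * n + 1))))}"

end

theory Submission
  imports Defs
begin

text \<open>
  Counting vertex-edge incidences by degree expresses \<open>i * n\<^sub>i\<close>, with \<open>n\<^sub>i\<close> the number of vertices of
  degree \<open>i\<close>, linearly in the \<open>x\<^sub>i\<^sub>j\<close>. Hence the order \<open>n\<close> and the size \<open>m\<close> are linear in the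
  \<open>x\<^sub>i\<^sub>j\<close> too.

  For the maximum these relations give \<open>Sigma = 6 n - 4 m - 4 x\<^sub>1\<^sub>2 - 2 x\<^sub>2\<^sub>2\<close>
  (\<open>Sigma_complement\<close>). So \<open>6 n - 4 m\<close> is an upper bound, with equality exactly when
  \<open>x\<^sub>1\<^sub>2 = x\<^sub>2\<^sub>2 = 0\<close>; and these two equations together with \<open>n\<close> and \<open>m\<close> leave one free
  parameter \<open>a = x\<^sub>1\<^sub>3\<close>, which is the family \<open>F6\<close> (\<open>mem_F6_iff\<close>).

  For the minimum the relation \<open>n\<^sub>3 - n\<^sub>1 = 2 (m - n)\<close> gives a lower bound on \<open>n\<^sub>3\<close>. The linear
  relations alone admit vectors that no connected simple graph has. They are excluded by three
  facts: if there are vertices of degree \<open>2\<close> and others, then some edge joins the two kinds;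
  \<open>x\<^sub>1\<^sub>2 \<le> x\<^sub>2\<^sub>3\<close> as soon as a vertex of degree \<open>3\<close> exists; and \<open>x\<^sub>3\<^sub>3\<close> is at most \<open>n\<^sub>3\<close> choose \<open>2\<close>.
  With them a short case distinction on \<open>m - n\<close> shows that \<open>Sigma\<close> is at least \<open>2\<close>, \<open>0\<close>, \<open>4\<close>, \<open>2\<close>
  for \<open>m = n - 1\<close>, \<open>m = n\<close>, \<open>m = n + 1\<close>, \<open>m > n + 1\<close>, with equality exactly on \<open>F7\<close>
  (\<open>Sigma_min_characterization\<close>).

  It remains to see that both bounds are attained for every admissible \<open>n\<close> and \<open>m\<close>. All the graphs
  needed have one shape: a path, possibly closed to a cycle, with chords and pendant vertices
  attached to distinct vertices of it (\<open>spine_graph\<close>). Such a graph is obviously connected, and its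
  degrees can be read off from positions on the path.
\<close>

section \<open>Counting edges by the degrees of their ends\<close>

definition degree_class :: "'a ugraph \<Rightarrow> nat \<Rightarrow> 'a set" where
  "degree_class G i = {v \<in> verts G. vertex_degree G v = i}"

definition edge_class :: "'a ugraph \<Rightarrow> nat \<Rightarrow> nat \<Rightarrow> 'a set set" where
  "edge_class G i j =
     {e \<in> edges G. \<exists>u v. e = {u, v} \<and> vertex_degree G u = i \<and> vertex_degree G v = j}"

lemma num_edges_card_edge_class: "num_edges G i j = card (edge_class G i j)"
  by (simp add: num_edges_def edge_class_def)

lemma doubleton_in_edge_class_iff:
  "{u, v} \<in> edge_class G i j \<longleftrightarrow> {u, v} \<in> edges G \<and>
     (vertex_degree G u = i \<and> vertex_degree G v = j \<or>
      vertex_degree G u = j \<and> vertex_degree G v = i)"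
  unfolding edge_class_def by (auto simp: doubleton_eq_iff)

lemma simple_graph_edgeE:
  assumes "simple_graph G" "e \<in> edges G"
  obtains u v where "e = {u, v}" "u \<noteq> v" "u \<in> verts G" "v \<in> verts G"
  using assms unfolding simple_graph_def by (metis card_2_iff insert_subset)

lemma simple_graph_finite_edges:
  assumes "simple_graph G" shows "finite (edges G)"
proof -
  have "edges G \<subseteq> Pow (verts G)" using assms by (auto simp: simple_graph_def)
  then show ?thesis using assms finite_subset by (fastforce simp: simple_graph_def)
qed

lemma vertex_degree_pos:
  assumes "simple_graph G" "e \<in> edges G" "v \<in> e"
  shows "vertex_degree G v > 0"
  using assms simple_graph_finite_edges[OF assms(1)] by (auto simp: vertex_degree_def card_gt_0_iff)

lemma connected_crossing_edge:
  assumes G: "simple_graph G" "graph_connected G"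
    and S: "S \<subseteq> verts G" "S \<noteq> {}" "S \<noteq> verts G"
  obtains u v where "u \<in> S" "v \<in> verts G - S" "{u, v} \<in> edges G"
proof (rule ccontr)
  assume no: "\<not> thesis"
  obtain a b where ab: "a \<in> S" "b \<in> verts G - S" using S by blast
  have "(a, b) \<in> (adj_rel G)\<^sup>*" using G ab S by (auto simp: graph_connected_def)
  then have "b \<in> S"
  proof (induction rule: rtrancl_induct)
    case base
    show ?case by (fact ab)
  next
    case (step y z)
    have e: "{y, z} \<in> edges G" using step by (auto simp: adj_rel_def)
    then have "z \<in> verts G" using G by (auto simp: simple_graph_def)
    then show ?case using no that e step by blast
  qed
  then show False using ab by blast
qed

text \<open>A vertex of \<open>S\<close> with a neighbour outside \<open>S\<close> can be removed from \<open>S\<close> together with the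
  edge to that neighbour, which no longer meets what is left of \<open>S\<close>. Repeating this assigns
  distinct edges to the vertices of \<open>S\<close>.\<close>

lemma connected_card_le_incident_edges:
  assumes G: "simple_graph G" "graph_connected G" and S: "S \<subset> verts G"
  shows "card S \<le> card {e \<in> edges G. e \<inter> S \<noteq> {}}"
  using S
proof (induction "card S" arbitrary: S)
  case 0
  then show ?case by simp
next
  case (Suc k)
  have finS: "finite S" using Suc.hyps(2) by (metis card.infinite nat.distinct(1))
  obtain u v where uv: "u \<in> S" "v \<in> verts G - S" "{u, v} \<in> edges G"
    using connected_crossing_edge[OF G, of S] Suc.prems Suc.hyps(2) by force
  let ?T = "S - {u}"
  have k: "k = card ?T" using Suc.hyps(2) finS uv by simp
  have le: "card ?T \<le> card {e \<in> edges G. e \<inter> ?T \<noteq> {}}"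
    using Suc.hyps(1)[OF k] Suc.prems by blast
  have fin: "finite {e \<in> edges G. e \<inter> S \<noteq> {}}" using simple_graph_finite_edges[OF G(1)] by simp
  have sub: "insert {u, v} {e \<in> edges G. e \<inter> ?T \<noteq> {}} \<subseteq> {e \<in> edges G. e \<inter> S \<noteq> {}}"
    using uv by blast
  have "{u, v} \<notin> {e \<in> edges G. e \<inter> ?T \<noteq> {}}" using uv by blast
  then have "Suc (card {e \<in> edges G. e \<inter> ?T \<noteq> {}}) = card (insert {u, v} {e \<in> edges G. e \<inter> ?T \<noteq> {}})"
    using simple_graph_finite_edges[OF G(1)] by simp
  also have "\<dots> \<le> card {e \<in> edges G. e \<inter> S \<noteq> {}}" by (rule card_mono[OF fin sub])
  finally show ?case using le k Suc.hyps(2) by linarith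
qed

lemma connected_order_le_Suc_size:
  assumes G: "simple_graph G" "graph_connected G"
  shows "graph_order G \<le> Suc (graph_size G)"
proof -
  obtain r where r: "r \<in> verts G" using G by (auto simp: graph_connected_def)
  have "card (verts G - {r}) \<le> card {e \<in> edges G. e \<inter> (verts G - {r}) \<noteq> {}}"
    by (rule connected_card_le_incident_edges[OF G]) (use r in auto)
  also have "\<dots> \<le> card (edges G)"
    by (rule card_mono) (auto simp: simple_graph_finite_edges[OF G(1)])
  finally show ?thesis using r G by (simp add: graph_order_def graph_size_def simple_graph_def)
qed

text \<open>Double counting of the pairs formed by a vertex of degree \<open>i\<close> and an edge through it.\<close>

lemma handshake_degree_class:
  assumes G: "simple_graph G"
  shows "i * card (degree_class G i) = (\<Sum>e\<in>edges G. card {v \<in> e. vertex_degree G v = i})"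
proof -
  let ?D = "degree_class G i"
  have finD: "finite ?D" using G by (simp add: degree_class_def simple_graph_def)
  have finE: "finite (edges G)" by (rule simple_graph_finite_edges[OF G])
  have "i * card ?D = (\<Sum>v\<in>?D. vertex_degree G v)"
    by (simp add: degree_class_def)
  also have "\<dots> = (\<Sum>v\<in>?D. \<Sum>e\<in>edges G. of_bool (v \<in> e))"
    using finE by (simp add: vertex_degree_def of_bool_def sum.If_cases Int_def)
  also have "\<dots> = (\<Sum>e\<in>edges G. \<Sum>v\<in>?D. of_bool (v \<in> e))" by (rule sum.swap)
  also have "\<dots> = (\<Sum>e\<in>edges G. card {v \<in> e. vertex_degree G v = i})"
  proof (rule sum.cong[OF refl])
    fix e assume "e \<in> edges G"
    then have "?D \<inter> {v. v \<in> e} = {v \<in> e. vertex_degree G v = i}"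
      using G by (auto simp: degree_class_def simple_graph_def)
    then show "(\<Sum>v\<in>?D. of_bool (v \<in> e)) = card {v \<in> e. vertex_degree G v = i}"
      using finD by (simp add: of_bool_def sum.If_cases)
  qed
  finally show ?thesis .
qed

section \<open>Linear relations in chemical graphs\<close>

text \<open>Two adjacent vertices of degree \<open>1\<close> would form a component, but the order is larger than \<open>2\<close>.\<close>

lemma chemical_no_11_edge:
  assumes "chemical_graph G" shows "edge_class G 1 1 = {}"
proof (rule ccontr)
  assume "edge_class G 1 1 \<noteq> {}"
  have G: "simple_graph G" "graph_connected G" "card (verts G) \<ge> 7"
    using assms by (auto simp: chemical_graph_def graph_order_def)
  from \<open>edge_class G 1 1 \<noteq> {}\<close> obtain e where e: "e \<in> edge_class G 1 1" by blast
  then have eE: "e \<in> edges G" by (simp add: edge_class_def)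
  obtain u v where uv: "e = {u, v}" "u \<noteq> v" "u \<in> verts G" "v \<in> verts G"
    by (rule simple_graph_edgeE[OF G(1) eE])
  have deg: "vertex_degree G u = 1" "vertex_degree G v = 1"
    using e unfolding uv doubleton_in_edge_class_iff by auto
  have only: "f = {u, v}" if "f \<in> edges G" "x \<in> f" "x \<in> {u, v}" for f x
  proof -
    have "card {f \<in> edges G. x \<in> f} = 1" using that deg by (auto simp: vertex_degree_def)
    then obtain g where "{f \<in> edges G. x \<in> f} = {g}" by (rule card_1_singletonE)
    moreover have "f \<in> {f \<in> edges G. x \<in> f}" "{u, v} \<in> {f \<in> edges G. x \<in> f}"
      using that eE unfolding uv(1) by blast+
    ultimately show ?thesis by (metis singletonD)
  qed
  have "card {u, v} = 2" using uv by simp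
  then have "{u, v} \<noteq> verts G" using G by auto
  then obtain x y where "x \<in> {u, v}" "y \<in> verts G - {u, v}" "{x, y} \<in> edges G"
    using connected_crossing_edge[OF G(1,2), of "{u, v}"] uv by auto
  then show False using only[of "{x, y}" x] by auto
qed

text \<open>The contribution of a single edge to each of the linear relations below; summing over all
  edges turns the indicators into the numbers \<open>x\<^sub>i\<^sub>j\<close>.\<close>

lemma edge_pointwise_count:
  assumes G: "chemical_graph G" and e: "e \<in> edges G"
  shows "card {v \<in> e. vertex_degree G v = 1} =
      of_bool (e \<in> edge_class G 1 2) + of_bool (e \<in> edge_class G 1 3)"
    "card {v \<in> e. vertex_degree G v = 2} =
      of_bool (e \<in> edge_class G 1 2) + 2 * of_bool (e \<in> edge_class G 2 2) + of_bool (e \<in> edge_class G 2 3)"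
    "card {v \<in> e. vertex_degree G v = 3} =
      of_bool (e \<in> edge_class G 1 3) + of_bool (e \<in> edge_class G 2 3) + 2 * of_bool (e \<in> edge_class G 3 3)"
    "1 = of_bool (e \<in> edge_class G 1 2) + of_bool (e \<in> edge_class G 1 3) + of_bool (e \<in> edge_class G 2 2)
       + of_bool (e \<in> edge_class G 2 3) + (of_bool (e \<in> edge_class G 3 3) :: nat)"
proof -
  have sG: "simple_graph G" using G by (simp add: chemical_graph_def)
  obtain u v where uv: "e = {u, v}" "u \<noteq> v" "u \<in> verts G" "v \<in> verts G"
    by (rule simple_graph_edgeE[OF sG e])
  have pos: "vertex_degree G u > 0" "vertex_degree G v > 0"
    using vertex_degree_pos[OF sG e] uv by auto
  have le: "vertex_degree G u \<le> 3" "vertex_degree G v \<le> 3" using G uv by (auto simp: chemical_graph_def)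
  have not11: "\<not> (vertex_degree G u = 1 \<and> vertex_degree G v = 1)"
    using chemical_no_11_edge[OF G] e uv doubleton_in_edge_class_iff[of u v G 1 1] by auto
  have u: "vertex_degree G u = 1 \<or> vertex_degree G u = 2 \<or> vertex_degree G u = 3"
    and v: "vertex_degree G v = 1 \<or> vertex_degree G v = 2 \<or> vertex_degree G v = 3"
    using pos le by linarith+
  have *: "card {x \<in> {u, v}. vertex_degree G x = i} =
      of_bool (vertex_degree G u = i) + of_bool (vertex_degree G v = i)" for i
  proof -
    have "{x \<in> {u, v}. vertex_degree G x = i} =
      (if vertex_degree G u = i then {u} else {}) \<union> (if vertex_degree G v = i then {v} else {})" by auto
    then show ?thesis using uv by auto
  qed
  have E: "{u, v} \<in> edges G" using e uv by simp
  show "card {v \<in> e. vertex_degree G v = 1} =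
      of_bool (e \<in> edge_class G 1 2) + of_bool (e \<in> edge_class G 1 3)"
    "card {v \<in> e. vertex_degree G v = 2} =
      of_bool (e \<in> edge_class G 1 2) + 2 * of_bool (e \<in> edge_class G 2 2) + of_bool (e \<in> edge_class G 2 3)"
    "card {v \<in> e. vertex_degree G v = 3} =
      of_bool (e \<in> edge_class G 1 3) + of_bool (e \<in> edge_class G 2 3) + 2 * of_bool (e \<in> edge_class G 3 3)"
    "1 = of_bool (e \<in> edge_class G 1 2) + of_bool (e \<in> edge_class G 1 3) + of_bool (e \<in> edge_class G 2 2)
       + of_bool (e \<in> edge_class G 2 3) + (of_bool (e \<in> edge_class G 3 3) :: nat)"
    unfolding uv(1) * doubleton_in_edge_class_iff using u v not11 E by (elim disjE; simp)+
qed

lemma sum_of_bool_edge_class: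
  assumes "simple_graph G"
  shows "(\<Sum>e\<in>edges G. of_bool (e \<in> edge_class G i j)) = num_edges G i j"
proof -
  have "edges G \<inter> {e. e \<in> edge_class G i j} = edge_class G i j" by (auto simp: edge_class_def)
  then show ?thesis
    using simple_graph_finite_edges[OF assms]
    by (simp add: of_bool_def sum.If_cases num_edges_card_edge_class)
qed

lemma chemical_linear_relations:
  assumes G: "chemical_graph G"
  shows "card (degree_class G 1) = num_edges G 1 2 + num_edges G 1 3"
    and "2 * card (degree_class G 2) = num_edges G 1 2 + 2 * num_edges G 2 2 + num_edges G 2 3"
    and "3 * card (degree_class G 3) = num_edges G 1 3 + num_edges G 2 3 + 2 * num_edges G 3 3"
    and "graph_size G = num_edges G 1 2 + num_edges G 1 3 + num_edges G 2 2 + num_edges G 2 3 + num_edges G 3 3"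
    and "graph_order G = card (degree_class G 1) + card (degree_class G 2) + card (degree_class G 3)"
proof -
  have sG: "simple_graph G" using G by (simp add: chemical_graph_def)
  note sums = sum.distrib sum_of_bool_edge_class[OF sG] mult_2
  note count = trans[OF handshake_degree_class[OF sG] sum.cong[OF refl]]
  have "1 * card (degree_class G 1) = num_edges G 1 2 + num_edges G 1 3"
    using count[OF edge_pointwise_count(1)[OF G]] unfolding sums .
  then show "card (degree_class G 1) = num_edges G 1 2 + num_edges G 1 3" by (simp only: mult_1)
  show "2 * card (degree_class G 2) = num_edges G 1 2 + 2 * num_edges G 2 2 + num_edges G 2 3"
    using count[OF edge_pointwise_count(2)[OF G]] unfolding sums .
  show "3 * card (degree_class G 3) = num_edges G 1 3 + num_edges G 2 3 + 2 * num_edges G 3 3"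
    using count[OF edge_pointwise_count(3)[OF G]] unfolding sums .
  have "graph_size G = (\<Sum>e\<in>edges G. 1)" by (simp add: graph_size_def)
  also have "\<dots> = (\<Sum>e\<in>edges G. of_bool (e \<in> edge_class G 1 2) + of_bool (e \<in> edge_class G 1 3) + of_bool (e \<in> edge_class G 2 2)
       + of_bool (e \<in> edge_class G 2 3) + of_bool (e \<in> edge_class G 3 3))"
    by (rule sum.cong[OF refl edge_pointwise_count(4)[OF G]])
  finally show "graph_size G = num_edges G 1 2 + num_edges G 1 3 + num_edges G 2 2 + num_edges G 2 3 + num_edges G 3 3"
    unfolding sums .
  have fin: "finite (verts G)" using sG by (simp add: simple_graph_def)
  have pos: "vertex_degree G v \<in> {1, 2, 3}" if v: "v \<in> verts G" for v
  proof -
    have "graph_order G \<noteq> card {v}" using G by (simp add: chemical_graph_def)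
    then have "{v} \<noteq> verts G" by (metis graph_order_def)
    then obtain w where "{v, w} \<in> edges G"
      using connected_crossing_edge[of G "{v}"] G v by (auto simp: chemical_graph_def)
    then have "vertex_degree G v > 0" using vertex_degree_pos[OF sG] by blast
    moreover have "vertex_degree G v \<le> 3" using G v by (simp add: chemical_graph_def)
    ultimately show ?thesis by auto
  qed
  have "verts G = degree_class G 1 \<union> degree_class G 2 \<union> degree_class G 3"
    using pos by (auto simp: degree_class_def)
  moreover have "finite (degree_class G i)" for i using fin by (simp add: degree_class_def)
  moreover have "degree_class G 1 \<inter> degree_class G 2 = {}"
    "(degree_class G 1 \<union> degree_class G 2) \<inter> degree_class G 3 = {}" by (auto simp: degree_class_def)
  ultimately show "graph_order G = card (degree_class G 1) + card (degree_class G 2) + card (degree_class G 3)"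
    unfolding graph_order_def by (metis card_Un_disjoint finite_UnI)
qed

lemma Sigma_index_eq:
  "Sigma_index G = real (num_edges G 1 2 + 4 * num_edges G 1 3 + num_edges G 2 3)"
  by (simp add: Sigma_index_def degree_based_index_def)

lemma chemical_size_bounds:
  assumes "chemical_graph G"
  shows "graph_order G \<ge> 7" "graph_order G \<le> Suc (graph_size G)"
    "2 * graph_size G + 3 \<le> 3 * graph_order G"
proof -
  show "graph_order G \<ge> 7" using assms by (simp add: chemical_graph_def)
  show "graph_order G \<le> Suc (graph_size G)"
    using assms connected_order_le_Suc_size by (auto simp: chemical_graph_def)
  have "real (graph_size G) \<le> (3 * real (graph_order G) - 3) / 2"
    using assms by (simp add: chemical_graph_def)
  then have "real (2 * graph_size G + 3) \<le> real (3 * graph_order G)" by simp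
  then show "2 * graph_size G + 3 \<le> 3 * graph_order G" by (simp only: of_nat_le_iff)
qed

text \<open>Eliminating \<open>x\<^sub>2\<^sub>3\<close> and \<open>x\<^sub>3\<^sub>3\<close> from the Sigma index by means of the order and the size
  leaves only the edges both of whose ends have degree at most \<open>2\<close>, with negative coefficients.\<close>

lemma Sigma_complement:
  assumes "chemical_graph G"
  shows "num_edges G 1 2 + 4 * num_edges G 1 3 + num_edges G 2 3
      + 4 * num_edges G 1 2 + 2 * num_edges G 2 2 + 4 * graph_size G = 6 * graph_order G"
  using chemical_linear_relations[OF assms] by linarith

text \<open>Once \<open>x\<^sub>1\<^sub>2 = x\<^sub>2\<^sub>2 = 0\<close>, the order and the size determine \<open>x\<^sub>2\<^sub>3\<close> and \<open>x\<^sub>3\<^sub>3\<close> from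
  \<open>a = x\<^sub>1\<^sub>3\<close>. The bounds on \<open>a\<close> in the definition of the family only say that these two numbers and
  \<open>a\<close> are not negative.\<close>

lemma mem_F6_iff:
  assumes G: "chemical_graph G"
  shows "G \<in> F6 \<longleftrightarrow> num_edges G 1 2 = 0 \<and> num_edges G 2 2 = 0"
proof
  assume "G \<in> F6"
  then obtain a b c where "edge_vector G = (0, a, 0, b, c)" unfolding F6_def Let_def by blast
  then show "num_edges G 1 2 = 0 \<and> num_edges G 2 2 = 0" by (simp add: edge_vector_def)
next
  assume z: "num_edges G 1 2 = 0 \<and> num_edges G 2 2 = 0"
  define n m a where "n = int (graph_order G)" and "m = int (graph_size G)"
    and "a = int (num_edges G 1 3)"
  have x23: "int (num_edges G 2 3) = 6 * n - 4 * m - 4 * a"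
    using Sigma_complement[OF G] z unfolding n_def m_def a_def by linarith
  moreover have x33: "int (num_edges G 3 3) = 5 * m - 6 * n + 3 * a"
    using Sigma_complement[OF G] chemical_linear_relations(4)[OF G] z
    unfolding n_def m_def a_def by linarith
  ultimately have "edge_vector G = (0, a, 0, 6 * n - 4 * m - 4 * a, 5 * m - 6 * n + 3 * a)"
    using z by (simp add: edge_vector_def a_def)
  moreover have "max 0 \<lceil>real_of_int (6 * n - 5 * m) / 3\<rceil> \<le> a"
  proof -
    have "6 * n - 5 * m \<le> 3 * a" using x33 by linarith
    then have "real_of_int (6 * n - 5 * m) \<le> real_of_int (3 * a)" by (simp only: of_int_le_iff)
    then have "\<lceil>real_of_int (6 * n - 5 * m) / 3\<rceil> \<le> a" by (simp add: ceiling_le_iff)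
    then show ?thesis by (simp add: a_def)
  qed
  moreover have "a \<le> \<lfloor>real_of_int (3 * n - 2 * m) / 2\<rfloor>"
  proof -
    have "2 * a \<le> 3 * n - 2 * m" using x23 by linarith
    then have "real_of_int (2 * a) \<le> real_of_int (3 * n - 2 * m)" by (simp only: of_int_le_iff)
    then show ?thesis by (simp add: le_floor_iff)
  qed
  ultimately show "G \<in> F6" using G unfolding F6_def Let_def n_def m_def by blast
qed

section \<open>Constraints on the edges between vertices of different degrees\<close>

lemma finite_edge_class: "simple_graph G \<Longrightarrow> finite (edge_class G i j)"
  by (simp add: edge_class_def simple_graph_finite_edges)

text \<open>Each component of the subgraph induced by the vertices of degree at most \<open>2\<close> sends an
  edge to a vertex of degree \<open>3\<close>, so these vertices are at most as many as the edges that they meet, which are all but the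
  \<open>(3,3)\<close>-edges. By the linear relations this inequality is the claim.\<close>

lemma num_12_le_num_23:
  assumes G: "chemical_graph G" and D3: "degree_class G 3 \<noteq> {}"
  shows "num_edges G 1 2 \<le> num_edges G 2 3"
proof -
  have sG: "simple_graph G" and cG: "graph_connected G" using G by (auto simp: chemical_graph_def)
  let ?S = "degree_class G 1 \<union> degree_class G 2"
  have fin: "finite (degree_class G i)" for i using sG by (simp add: degree_class_def simple_graph_def)
  have S: "?S \<subset> verts G"
  proof -
    obtain x where "x \<in> verts G" "vertex_degree G x = 3" using D3 by (auto simp: degree_class_def)
    then have "x \<notin> ?S" by (simp add: degree_class_def)
    then show ?thesis using \<open>x \<in> verts G\<close> unfolding degree_class_def by blast
  qed
  have "degree_class G 1 \<inter> degree_class G 2 = {}" by (auto simp: degree_class_def)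
  then have "card (degree_class G 1) + card (degree_class G 2) = card ?S"
    by (simp add: card_Un_disjoint fin)
  also have "\<dots> \<le> card {e \<in> edges G. e \<inter> ?S \<noteq> {}}"
    by (rule connected_card_le_incident_edges[OF sG cG S])
  also have "\<dots> \<le> card (edges G - edge_class G 3 3)"
  proof (rule card_mono)
    show "finite (edges G - edge_class G 3 3)" using simple_graph_finite_edges[OF sG] by simp
    show "{e \<in> edges G. e \<inter> ?S \<noteq> {}} \<subseteq> edges G - edge_class G 3 3"
      by (auto simp: edge_class_def degree_class_def)
  qed
  also have "\<dots> = graph_size G - num_edges G 3 3"
    unfolding graph_size_def num_edges_card_edge_class
    by (rule card_Diff_subset[OF finite_edge_class[OF sG]]) (auto simp: edge_class_def)
  finally show ?thesis using chemical_linear_relations[OF G] by linarith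
qed

lemma edge_leaving_degree_2:
  assumes G: "chemical_graph G" and D2: "degree_class G 2 \<noteq> {}"
    and D13: "degree_class G 1 \<union> degree_class G 3 \<noteq> {}"
  shows "num_edges G 1 2 + num_edges G 2 3 > 0"
proof -
  have sG: "simple_graph G" and cG: "graph_connected G" using G by (auto simp: chemical_graph_def)
  have sub: "degree_class G 2 \<subseteq> verts G" by (simp add: degree_class_def)
  obtain x where "x \<in> verts G" "vertex_degree G x \<noteq> 2" using D13 by (auto simp: degree_class_def)
  then have ne: "degree_class G 2 \<noteq> verts G" unfolding degree_class_def by blast
  obtain u v where uv: "u \<in> degree_class G 2" "v \<in> verts G - degree_class G 2" "{u, v} \<in> edges G"
    by (rule connected_crossing_edge[OF sG cG sub D2 ne])
  have "vertex_degree G v > 0" using vertex_degree_pos[OF sG uv(3)] by blast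
  moreover have "vertex_degree G v \<le> 3" "vertex_degree G v \<noteq> 2"
    using uv G by (auto simp: chemical_graph_def degree_class_def)
  ultimately have "vertex_degree G v = 1 \<or> vertex_degree G v = 3" by linarith
  then have "{u, v} \<in> edge_class G 1 2 \<union> edge_class G 2 3"
    using uv by (auto simp: doubleton_in_edge_class_iff degree_class_def)
  then show ?thesis
    using finite_edge_class[OF sG] by (auto simp: num_edges_card_edge_class card_gt_0_iff)
qed

lemma num_33_le_choose:
  assumes G: "chemical_graph G"
  shows "num_edges G 3 3 \<le> card (degree_class G 3) choose 2"
proof -
  have sG: "simple_graph G" using G by (auto simp: chemical_graph_def)
  have fin: "finite (degree_class G 3)" using sG by (simp add: degree_class_def simple_graph_def)
  have "edge_class G 3 3 \<subseteq> {B. B \<subseteq> degree_class G 3 \<and> card B = 2}"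
    using sG by (auto simp: edge_class_def degree_class_def simple_graph_def)
  moreover have "finite {B. B \<subseteq> degree_class G 3 \<and> card B = 2}" using fin by simp
  ultimately have "card (edge_class G 3 3) \<le> card {B. B \<subseteq> degree_class G 3 \<and> card B = 2}"
    by (intro card_mono)
  then show ?thesis by (simp only: num_edges_card_edge_class n_subsets[OF fin])
qed

section \<open>The minimum of the Sigma index\<close>

definition Sigma_min :: "nat \<Rightarrow> nat \<Rightarrow> nat" where
  "Sigma_min n m = (if m = n then 0 else if m = n + 1 then 4 else 2)"

text \<open>In each range of \<open>m\<close> a small value of \<open>\<sigma>\<close> leaves finitely many possibilities for
  \<open>(x\<^sub>1\<^sub>2, x\<^sub>1\<^sub>3, x\<^sub>2\<^sub>3)\<close>, which the order and the size complete to the whole vector. For \<open>m > n\<close> there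
  is a vertex of degree \<open>3\<close>, so \<open>x\<^sub>1\<^sub>2 \<le> x\<^sub>2\<^sub>3\<close>, and \<open>x\<^sub>1\<^sub>2 + x\<^sub>2\<^sub>3\<close> is even because the degrees of the
  vertices of degree \<open>2\<close> have an even sum; hardly any candidate survives this.\<close>

lemma Sigma_min_characterization:
  assumes G: "chemical_graph G"
  defines "\<sigma> \<equiv> num_edges G 1 2 + 4 * num_edges G 1 3 + num_edges G 2 3"
  shows "Sigma_min (graph_order G) (graph_size G) \<le> \<sigma>"
    and "G \<in> F7 \<longleftrightarrow> \<sigma> = Sigma_min (graph_order G) (graph_size G)"
proof -
  define n m where "n = graph_order G" and "m = graph_size G"
  define x12 x13 x22 x23 x33 where
    "x12 = num_edges G 1 2" and "x13 = num_edges G 1 3" and "x22 = num_edges G 2 2" and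
    "x23 = num_edges G 2 3" and "x33 = num_edges G 3 3"
  define n1 n2 n3 where "n1 = card (degree_class G 1)" and "n2 = card (degree_class G 2)"
    and "n3 = card (degree_class G 3)"
  note defs = n_def m_def x12_def x13_def x22_def x23_def x33_def n1_def n2_def n3_def
  have sG: "simple_graph G" using G by (auto simp: chemical_graph_def)
  have fin: "finite (degree_class G i)" for i using sG by (simp add: degree_class_def simple_graph_def)
  have rel: "n1 = x12 + x13" "2 * n2 = x12 + 2 * x22 + x23" "3 * n3 = x13 + x23 + 2 * x33"
      "m = x12 + x13 + x22 + x23 + x33" "n = n1 + n2 + n3"
    unfolding defs by (rule chemical_linear_relations[OF G])+
  have n7: "n \<ge> 7" and nm: "n \<le> m + 1" and mn: "2 * m + 3 \<le> 3 * n"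
    using chemical_size_bounds[OF G] unfolding defs by simp_all
  have le: "x12 \<le> x23" if "n3 > 0"
    using num_12_le_num_23[OF G] that fin unfolding defs by (simp add: card_gt_0_iff)
  have cross: "x12 + x23 > 0" if "n2 > 0" "n1 + n3 > 0"
    using edge_leaving_degree_2[OF G] that fin unfolding defs by (simp add: card_gt_0_iff)
  have choose: "x33 \<le> n3 choose 2" using num_33_le_choose[OF G] unfolding defs .
  have \<sigma>: "\<sigma> = x12 + 4 * x13 + x23" by (simp add: \<sigma>_def defs)
  let ?v = "(int x12, int x13, int x22, int x23, int x33)"
  have F7: "G \<in> F7 \<longleftrightarrow>
      (int m = int n - 1 \<and> ?v = (2, 0, int m - 2, 0, 0)) \<or>
      (m = n \<and> ?v = (0, 0, int m, 0, 0)) \<or>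
      (m = n + 1 \<and> (?v = (0, 0, int m - 5, 4, 1) \<or> ?v = (1, 0, int m - 7, 3, 3) \<or>
         (n \<ge> 8 \<and> ?v = (2, 0, int m - 9, 2, 5)))) \<or>
      (n + 1 < m \<and>
        (?v = (0, 0, 3 * int n - 2 * int m - 1, 2, 3 * int m - 3 * int n - 1) \<or>
         ?v = (1, 0, 3 * int n - 2 * int m - 3, 1, 3 * int m - 3 * int n + 1)))" (is "_ \<longleftrightarrow> ?F")
  proof -
    have "real (2 * m + 3) \<le> real (3 * n)" using mn by (simp only: of_nat_le_iff)
    then have "real_of_int (int m) \<le> real_of_int (3 * int n - 3) / 2" by simp
    moreover have "int m = int n \<longleftrightarrow> m = n" "int m = int n + 1 \<longleftrightarrow> m = n + 1"
      "int n + 1 < int m \<longleftrightarrow> n + 1 < m" "8 \<le> int n \<longleftrightarrow> 8 \<le> n" by linarith+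
    ultimately show ?thesis
      using G unfolding F7_def edge_vector_def Let_def mem_Collect_eq defs[symmetric]
      by (simp only: simp_thms)
  qed
  have n3: "n3 + 2 * n = n1 + 2 * m" using rel by linarith
  consider "m + 1 = n" | "m = n" | "m = n + 1" | "m > n + 1" using nm by linarith
  then have "Sigma_min n m \<le> \<sigma> \<and> (?F \<longleftrightarrow> \<sigma> = Sigma_min n m)"
  proof cases
    case 1
    then have "?F \<longleftrightarrow> x12 = 2 \<and> x13 = 0 \<and> x22 + 2 = m \<and> x23 = 0 \<and> x33 = 0" by auto
    also have "\<dots> \<longleftrightarrow> \<sigma> = 2"
      using rel 1 unfolding \<sigma> by (intro iffI conjI; (elim conjE)?; linarith)
    moreover have "2 \<le> \<sigma>" using rel 1 unfolding \<sigma> by linarith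
    ultimately show ?thesis using 1 by (simp add: Sigma_min_def)
  next
    case 2
    then have "?F \<longleftrightarrow> x12 = 0 \<and> x13 = 0 \<and> x22 = m \<and> x23 = 0 \<and> x33 = 0" by auto
    also have "\<dots> \<longleftrightarrow> \<sigma> = 0"
      using rel 2 unfolding \<sigma> by (intro iffI conjI; (elim conjE)?; linarith)
    finally show ?thesis using 2 by (simp add: Sigma_min_def)
  next
    case 3
    have n3': "n3 = n1 + 2" using n3 3 by linarith
    have small: "x13 = 0 \<and> x12 + x23 = 4 \<and> x12 \<le> 2" if "\<sigma> \<le> 4"
    proof -
      have x13: "x13 = 0"
      proof (rule ccontr)
        \<comment> \<open>A \<open>(1,3)\<close>-edge already costs \<open>4\<close>, so no edge could leave the vertices of degree \<open>2\<close>.\<close>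
        assume "x13 \<noteq> 0"
        then have "x13 = 1" "x12 = 0" "x23 = 0" using that unfolding \<sigma> by linarith+
        then show False using cross rel n3' n7 by linarith
      qed
      have "even (x12 + x23)" using rel(2) by presburger
      moreover have "x12 \<le> x23" using le n3' by linarith
      moreover have "x12 + x23 \<le> 4" using that unfolding \<sigma> by linarith
      ultimately have "x12 = 0 \<and> x23 = 0 \<or> x12 = 0 \<and> x23 = 2 \<or> x12 = 1 \<and> x23 = 1
        \<or> x12 + x23 = 4 \<and> x12 \<le> 2" by presburger
      then consider "x12 = 0" "x23 = 0" | "x12 = 0" "x23 = 2" | "x12 = 1" "x23 = 1"
        | "x12 + x23 = 4" "x12 \<le> 2" by blast
      then show ?thesis
      proof cases
        case 1
        then show ?thesis using cross rel n3' n7 x13 by linarith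
      next
        \<comment> \<open>The next two cases need more \<open>(3,3)\<close>-edges than a simple graph on so few vertices has.\<close>
        case 2
        then have "n3 = 2" "x33 = 2" using rel n3' x13 by linarith+
        then show ?thesis using choose by simp
      next
        case 3
        then have "n3 = 3" "x33 = 4" using rel n3' x13 by linarith+
        then show ?thesis using choose by (simp add: numeral_3_eq_3 numeral_2_eq_2)
      qed (simp_all add: x13)
    qed
    have F: "?F \<longleftrightarrow> x13 = 0 \<and> (x12 = 0 \<and> x22 + 5 = m \<and> x23 = 4 \<and> x33 = 1 \<or>
        x12 = 1 \<and> x22 + 7 = m \<and> x23 = 3 \<and> x33 = 3 \<or>
        x12 = 2 \<and> x22 + 9 = m \<and> x23 = 2 \<and> x33 = 5)" (is "_ \<longleftrightarrow> ?F'")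
      using 3 by auto
    have "\<sigma> = 4" if ?F' using that unfolding \<sigma> by auto
    moreover have ?F' if "\<sigma> = 4"
    proof -
      have "x13 = 0" "x12 + x23 = 4" "x12 = 0 \<or> x12 = 1 \<or> x12 = 2" using small that by linarith+
      moreover from this have "x33 = 2 * x12 + 1" "x22 + 2 * x12 + 5 = m" using rel n3' by linarith+
      ultimately show ?thesis by auto
    qed
    moreover have "4 \<le> \<sigma>" using small unfolding \<sigma> by linarith
    moreover have "Sigma_min n m = 4" using 3 by (simp add: Sigma_min_def)
    ultimately show ?thesis unfolding F by metis
  next
    case 4
    have n3': "n3 \<ge> n1 + 4" using n3 4 by linarith
    have small: "x13 = 0 \<and> x12 + x23 = 2 \<and> x12 \<le> 1" if "\<sigma> \<le> 2"
    proof -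
      have x13: "x13 = 0" using that unfolding \<sigma> by linarith
      have "even (x12 + x23)" using rel(2) by presburger
      moreover have "x12 \<le> x23" using le n3' by linarith
      moreover have "x12 + x23 \<le> 2" using that unfolding \<sigma> by linarith
      ultimately have "x12 = 0 \<and> x23 = 0 \<or> x12 + x23 = 2 \<and> x12 \<le> 1" by presburger
      then consider "x12 = 0" "x23 = 0" | "x12 + x23 = 2" "x12 \<le> 1" by blast
      then show ?thesis
      proof cases
        case 1
        then show ?thesis using cross rel n3 n3' mn x13 by linarith
      qed (simp_all add: x13)
    qed
    have F: "?F \<longleftrightarrow> x13 = 0 \<and>
        (x12 = 0 \<and> x22 + 2 * m + 1 = 3 * n \<and> x23 = 2 \<and> x33 + 3 * n + 1 = 3 * m \<or>
         x12 = 1 \<and> x22 + 2 * m + 3 = 3 * n \<and> x23 = 1 \<and> x33 + 3 * n = 3 * m + 1)" (is "_ \<longleftrightarrow> ?F'")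
      using 4 by auto
    have "\<sigma> = 2" if ?F' using that unfolding \<sigma> by auto
    moreover have ?F' if "\<sigma> = 2"
    proof -
      have "x13 = 0" "x12 + x23 = 2" "x12 = 0 \<or> x12 = 1" using small that by linarith+
      moreover from this have "x33 + 3 * n + 1 = 3 * m + 2 * x12" "x22 + 2 * m + 2 * x12 + 1 = 3 * n"
        using rel by linarith+
      ultimately show ?thesis by auto
    qed
    moreover have "2 \<le> \<sigma>" using small unfolding \<sigma> by linarith
    moreover have "Sigma_min n m = 2" using 4 by (simp add: Sigma_min_def)
    ultimately show ?thesis unfolding F by metis
  qed
  then have both: "Sigma_min n m \<le> \<sigma> \<and> (G \<in> F7 \<longleftrightarrow> \<sigma> = Sigma_min n m)" unfolding F7 .
  show "Sigma_min (graph_order G) (graph_size G) \<le> \<sigma>"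
    and "G \<in> F7 \<longleftrightarrow> \<sigma> = Sigma_min (graph_order G) (graph_size G)"
    using both unfolding n_def m_def by blast+
qed

section \<open>Isomorphic copies\<close>

definition image_graph :: "('a \<Rightarrow> 'b) \<Rightarrow> 'a ugraph \<Rightarrow> 'b ugraph" where
  "image_graph h G = \<lparr>verts = h ` verts G, edges = (`) h ` edges G\<rparr>"

lemma inj_on_image_edges:
  assumes "simple_graph G" "inj_on h (verts G)"
  shows "inj_on ((`) h) (edges G)"
proof (rule inj_on_subset[OF inj_on_image_Pow[OF assms(2)]])
  show "edges G \<subseteq> Pow (verts G)" using assms(1) by (auto simp: simple_graph_def)
qed

lemma vertex_degree_image_graph:
  assumes G: "simple_graph G" and h: "inj_on h (verts G)" and v: "v \<in> verts G"
  shows "vertex_degree (image_graph h G) (h v) = vertex_degree G v"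
proof -
  have mem: "h v \<in> h ` e \<longleftrightarrow> v \<in> e" if "e \<in> edges G" for e
    using G that h v by (auto simp: simple_graph_def dest: inj_onD)
  then have "{e \<in> (`) h ` edges G. h v \<in> e} = (`) h ` {e \<in> edges G. v \<in> e}" by auto
  moreover have "inj_on ((`) h) {e \<in> edges G. v \<in> e}"
    by (rule inj_on_subset[OF inj_on_image_edges[OF G h]]) blast
  ultimately show ?thesis by (simp add: vertex_degree_def image_graph_def card_image)
qed

lemma simple_image_graph:
  assumes G: "simple_graph G" and h: "inj_on h (verts G)"
  shows "simple_graph (image_graph h G)"
  unfolding simple_graph_def
proof (intro conjI ballI)
  show "finite (verts (image_graph h G))" using G by (simp add: image_graph_def simple_graph_def)
next
  fix e' assume "e' \<in> edges (image_graph h G)"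
  then obtain e where e: "e \<in> edges G" "e' = h ` e" by (auto simp: image_graph_def)
  have sub: "e \<subseteq> verts G" "card e = 2" using G e by (auto simp: simple_graph_def)
  show "e' \<subseteq> verts (image_graph h G)" using sub e by (auto simp: image_graph_def)
  show "card e' = 2" using sub e card_image[OF inj_on_subset[OF h sub(1)]] by simp
qed

lemma num_edges_image_graph:
  assumes G: "simple_graph G" and h: "inj_on h (verts G)"
  shows "num_edges (image_graph h G) i j = num_edges G i j"
proof -
  have "h ` e \<in> edge_class (image_graph h G) i j \<longleftrightarrow> e \<in> edge_class G i j" if e: "e \<in> edges G" for e
  proof -
    obtain u v where uv: "e = {u, v}" "u \<in> verts G" "v \<in> verts G" by (rule simple_graph_edgeE[OF G e])
    have "h ` {u, v} \<in> edges (image_graph h G)"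
      using e unfolding uv(1) image_graph_def ugraph.simps by (rule imageI)
    then have "{h u, h v} \<in> edges (image_graph h G)" by simp
    then show ?thesis
      using e unfolding uv(1) image_insert image_empty doubleton_in_edge_class_iff
      by (simp add: vertex_degree_image_graph[OF G h] uv)
  qed
  moreover have "edge_class (image_graph h G) i j \<subseteq> (`) h ` edges G" "edge_class G i j \<subseteq> edges G"
    by (simp_all add: edge_class_def image_graph_def subset_iff)
  ultimately have "edge_class (image_graph h G) i j = (`) h ` edge_class G i j" by blast
  moreover have "inj_on ((`) h) (edge_class G i j)"
    by (rule inj_on_subset[OF inj_on_image_edges[OF G h]]) (auto simp: edge_class_def)
  ultimately show ?thesis by (simp add: num_edges_card_edge_class card_image)
qed

lemma connected_image_graph:
  assumes G: "graph_connected G"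
  shows "graph_connected (image_graph h G)"
proof -
  have "(h u, h v) \<in> (adj_rel (image_graph h G))\<^sup>*" if "(u, v) \<in> (adj_rel G)\<^sup>*" for u v
    using that
  proof (induction rule: rtrancl_induct)
    case (step y z)
    then have "{y, z} \<in> edges G" by (simp add: adj_rel_def)
    then have "h ` {y, z} \<in> edges (image_graph h G)"
      unfolding image_graph_def ugraph.simps by (rule imageI)
    then have "(h y, h z) \<in> adj_rel (image_graph h G)" by (simp add: adj_rel_def)
    then show ?case using step by (meson rtrancl.rtrancl_into_rtrancl)
  qed simp
  then show ?thesis using G by (auto simp: graph_connected_def image_graph_def)
qed

text \<open>Competitors for graphs on any vertex type can therefore be constructed on the natural numbers.\<close>

lemma chemical_copy_exists:
  fixes G :: "'a ugraph" and V :: "'b set"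
  assumes G: "chemical_graph G" and V: "graph_order G = card V"
  obtains H :: "'b ugraph" where "chemical_graph H" "graph_order H = graph_order G"
    "graph_size H = graph_size G" "\<And>i j. num_edges H i j = num_edges G i j"
proof -
  have sG: "simple_graph G" and cG: "graph_connected G" using G by (auto simp: chemical_graph_def)
  have "card V > 0" using G V by (simp add: chemical_graph_def)
  then have "finite V" "finite (verts G)" using sG by (auto simp: card_gt_0_iff simple_graph_def)
  then obtain h where h: "bij_betw h (verts G) V"
    using finite_same_card_bij V unfolding graph_order_def by blast
  then have inj: "inj_on h (verts G)" by (simp add: bij_betw_def)
  let ?H = "image_graph h G"
  have order: "graph_order ?H = graph_order G"
    by (simp add: graph_order_def image_graph_def card_image[OF inj])
  have size: "graph_size ?H = graph_size G"
    by (simp add: graph_size_def image_graph_def card_image[OF inj_on_image_edges[OF sG inj]])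
  have "vertex_degree ?H w \<le> 3" if w: "w \<in> verts ?H" for w
  proof -
    obtain v where "v \<in> verts G" "w = h v" using w by (auto simp: image_graph_def)
    then show ?thesis using G vertex_degree_image_graph[OF sG inj] by (simp add: chemical_graph_def)
  qed
  then have "chemical_graph ?H"
    using G simple_image_graph[OF sG inj] connected_image_graph[OF cG] order size
    by (simp add: chemical_graph_def)
  then show ?thesis using that order size num_edges_image_graph[OF sG inj] by blast
qed

section \<open>Paths and cycles with chords and pendant vertices\<close>

definition pairs :: "(nat \<Rightarrow> nat) \<Rightarrow> (nat \<Rightarrow> nat) \<Rightarrow> nat \<Rightarrow> nat set set" where
  "pairs f g k = (\<lambda>i. {f i, g i}) ` {..<k}"

lemma finite_pairs [simp]: "finite (pairs f g k)"
  by (simp add: pairs_def)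

lemma card_pairs:
  assumes "inj_on (\<lambda>i. {f i, g i}) {..<k}"
  shows "card (pairs f g k) = k"
  using card_image[OF assms] by (simp add: pairs_def)

text \<open>The injectivity assumptions say that the edges are distinct and that each of the two ends
  runs through distinct vertices, so each of \<open>f\<close> and \<open>g\<close> contributes at most one edge at \<open>v\<close>.\<close>

lemma card_incident_pairs:
  assumes inj: "inj_on (\<lambda>i. {f i, g i}) {..<k}" "inj_on f {..<k}" "inj_on g {..<k}"
    and ne: "\<And>i. i < k \<Longrightarrow> f i \<noteq> g i"
  shows "card {e \<in> pairs f g k. v \<in> e} = of_bool (v \<in> f ` {..<k}) + of_bool (v \<in> g ` {..<k})"
proof -
  have fibre: "card {i \<in> {..<k}. h i = v} = of_bool (v \<in> h ` {..<k})" if h: "inj_on h {..<k}" for h :: "nat \<Rightarrow> nat"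
  proof (cases "v \<in> h ` {..<k}")
    case True
    then obtain j where "j < k" "h j = v" by auto
    then have "{i \<in> {..<k}. h i = v} = {j}" using h by (auto dest: inj_onD)
    then show ?thesis using True by simp
  next
    case False
    then have "{i \<in> {..<k}. h i = v} = {}" by auto
    then show ?thesis using False by simp
  qed
  let ?A = "\<lambda>h. {i \<in> {..<k}. h i = v}"
  have incident: "{e \<in> pairs f g k. v \<in> e} = (\<lambda>i. {f i, g i}) ` (?A f \<union> ?A g)"
    by (auto simp: pairs_def)
  have "card {e \<in> pairs f g k. v \<in> e} = card (?A f \<union> ?A g)"
    unfolding incident by (rule card_image[OF inj_on_subset[OF inj(1)]]) auto
  also have "\<dots> = card (?A f) + card (?A g)"
  proof (rule card_Un_disjoint)
    have "f i \<noteq> v \<or> g i \<noteq> v" if "i < k" for i using ne[OF that] by metis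
    then show "?A f \<inter> ?A g = {}" by blast
  qed simp_all
  finally show ?thesis by (simp only: fibre[OF inj(2)] fibre[OF inj(3)])
qed

text \<open>The four groups of edges are: the path \<open>0, \<dots>, c - 1\<close>; its closing edge, present if \<open>l = 1\<close>;
  \<open>k\<close> chords from the first \<open>k\<close> vertices to vertices \<open>s\<close> places further on; and \<open>b\<close> edges to the
  pendant vertices \<open>c, \<dots>, c + b - 1\<close>. The pendant vertices hang at \<open>r + 1, \<dots>, r + b - 1\<close> and at one
  more place \<open>q\<close>: this single displaced one makes room for a vertex of degree \<open>2\<close> inside a tree,
  and separates the two ends of the chords in a cycle.\<close>

definition spine_graph :: "nat \<Rightarrow> nat \<Rightarrow> nat \<Rightarrow> nat \<Rightarrow> nat \<Rightarrow> nat \<Rightarrow> nat \<Rightarrow> nat ugraph" where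
  "spine_graph c l k s q r b =
     \<lparr>verts = {..<c + b},
      edges = pairs id Suc (c - 1) \<union> pairs (\<lambda>_. 0) (\<lambda>_. c - 1) l \<union> pairs id (\<lambda>i. i + s) k \<union>
        pairs (\<lambda>j. if j = 0 then q else r + j) (\<lambda>j. c + j) b\<rparr>"

lemma verts_spine_graph [simp]: "verts (spine_graph c l k s q r b) = {..<c + b}"
  by (simp add: spine_graph_def)

text \<open>The bounds make the four groups of edges disjoint: a chord is not an edge of the path or
  the closing edge. They also make the starts of the chords differ from their ends and the
  pendant vertices hang at distinct places.\<close>

locale spine =
  fixes c l k s q r b :: nat
  assumes c: "4 \<le> c" and l: "l \<le> 1" and chord: "k = 0 \<or> 2 \<le> s \<and> s + 1 < c" "k \<le> s" "k + s \<le> c"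
    and leaf: "q \<le> r" "r + b \<le> c" "q < c"
begin

abbreviation "G \<equiv> spine_graph c l k s q r b"
abbreviation "p \<equiv> \<lambda>j. if j = 0 then q else r + j"

lemma inj_pairs:
  "inj_on (\<lambda>i. {id i, Suc i}) {..<c - 1}" "inj_on (\<lambda>_. {0, c - 1}) {..<l}"
  "inj_on (\<lambda>i. {id i, i + s}) {..<k}" "inj_on (\<lambda>j. {p j, c + j}) {..<b}"
proof -
  show "inj_on (\<lambda>i. {id i, Suc i}) {..<c - 1}"
    by (rule inj_onI) (auto simp: doubleton_eq_iff)
  show "inj_on (\<lambda>_. {0, c - 1}) {..<l}" using l by (auto intro: inj_onI)
  show "inj_on (\<lambda>i. {id i, i + s}) {..<k}"
    by (rule inj_onI) (auto simp: doubleton_eq_iff)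
  show "inj_on (\<lambda>j. {p j, c + j}) {..<b}"
  proof (rule inj_onI)
    fix i j assume ij: "i \<in> {..<b}" "j \<in> {..<b}" "{p i, c + i} = {p j, c + j}"
    have "p i < c" using leaf ij by auto
    then show "i = j" using ij(3) by (auto simp only: doubleton_eq_iff)
  qed
qed

lemma disjoint_pairs:
  "pairs id Suc (c - 1) \<inter> pairs (\<lambda>_. 0) (\<lambda>_. c - 1) l = {}"
  "(pairs id Suc (c - 1) \<union> pairs (\<lambda>_. 0) (\<lambda>_. c - 1) l) \<inter> pairs id (\<lambda>i. i + s) k = {}"
  "(pairs id Suc (c - 1) \<union> pairs (\<lambda>_. 0) (\<lambda>_. c - 1) l \<union> pairs id (\<lambda>i. i + s) k) \<inter>
     pairs p (\<lambda>j. c + j) b = {}"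
proof -
  show "pairs id Suc (c - 1) \<inter> pairs (\<lambda>_. 0) (\<lambda>_. c - 1) l = {}"
    using c by (auto simp: pairs_def doubleton_eq_iff)
  show "(pairs id Suc (c - 1) \<union> pairs (\<lambda>_. 0) (\<lambda>_. c - 1) l) \<inter> pairs id (\<lambda>i. i + s) k = {}"
    using c chord by (auto simp: pairs_def doubleton_eq_iff)
  have "e \<subseteq> {..<c}" if "e \<in> pairs id Suc (c - 1) \<union> pairs (\<lambda>_. 0) (\<lambda>_. c - 1) l \<union> pairs id (\<lambda>i. i + s) k" for e
    using that c chord by (auto simp: pairs_def)
  moreover have "\<not> e \<subseteq> {..<c}" if "e \<in> pairs p (\<lambda>j. c + j) b" for e
    using that by (auto simp: pairs_def)
  ultimately show "(pairs id Suc (c - 1) \<union> pairs (\<lambda>_. 0) (\<lambda>_. c - 1) l \<union> pairs id (\<lambda>i. i + s) k) \<inter>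
     pairs p (\<lambda>j. c + j) b = {}" by blast
qed

lemma order: "graph_order G = c + b"
  by (simp add: graph_order_def spine_graph_def)

lemma size: "graph_size G = c - 1 + l + k + b"
  unfolding graph_size_def spine_graph_def ugraph.simps
  by (simp only: card_Un_disjoint disjoint_pairs finite_pairs finite_Un simp_thms
      card_pairs[OF inj_pairs(1)] card_pairs[OF inj_pairs(2)]
      card_pairs[OF inj_pairs(3)] card_pairs[OF inj_pairs(4)])

lemma edge_cases:
  assumes "e \<in> edges G"
  obtains i where "e = {i, Suc i}" "Suc i < c" | "l = 1" "e = {0, c - 1}"
    | i where "e = {i, i + s}" "i < k" | j where "e = {p j, c + j}" "j < b"
proof -
  consider "e \<in> pairs id Suc (c - 1)" | "e \<in> pairs (\<lambda>_. 0) (\<lambda>_. c - 1) l"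
    | "e \<in> pairs id (\<lambda>i. i + s) k" | "e \<in> pairs p (\<lambda>j. c + j) b"
    using assms unfolding spine_graph_def ugraph.simps by blast
  then show ?thesis
  proof cases
    case 1
    then obtain i where "i < c - 1" "e = {i, Suc i}" by (auto simp: pairs_def)
    then show ?thesis using that(1) by simp
  next
    case 2
    then show ?thesis using that(2) l by (auto simp: pairs_def)
  next
    case 3
    then show ?thesis using that(3) by (auto simp: pairs_def)
  next
    case 4
    then show ?thesis using that(4) unfolding pairs_def by blast
  qed
qed

lemma simple: "simple_graph G"
proof -
  have "e \<subseteq> {..<c + b} \<and> card e = 2" if "e \<in> edges G" for e
  proof -
    from that show ?thesis
    proof (cases rule: edge_cases)
      case (4 j)
      define x where "x = p j"
      have "x < c" using leaf 4 by (auto simp: x_def)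
      moreover have "e = {x, c + j}" using 4 by (simp add: x_def)
      ultimately show ?thesis using 4 by simp
    qed (use c chord in auto)
  qed
  then show ?thesis by (auto simp: simple_graph_def spine_graph_def)
qed

lemma degree:
  "vertex_degree G v =
     of_bool (v + 1 < c) + of_bool (0 < v \<and> v < c) + l * (of_bool (v = 0) + of_bool (v + 1 = c))
     + of_bool (v < k) + of_bool (s \<le> v \<and> v < k + s)
     + of_bool (0 < b \<and> v = q \<or> r < v \<and> v < r + b) + of_bool (c \<le> v \<and> v < c + b)"
proof -
  let ?P1 = "pairs id Suc (c - 1)" and ?P2 = "pairs (\<lambda>_. 0) (\<lambda>_. c - 1) l"
    and ?P3 = "pairs id (\<lambda>i. i + s) k" and ?P4 = "pairs p (\<lambda>j. c + j) b"
  let ?I = "\<lambda>P. {e \<in> P. v \<in> e}"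
  have incident: "{e \<in> edges G. v \<in> e} = ((?I ?P1 \<union> ?I ?P2) \<union> ?I ?P3) \<union> ?I ?P4"
    unfolding spine_graph_def ugraph.simps by blast
  have "vertex_degree G v = card (?I ?P1) + card (?I ?P2) + card (?I ?P3) + card (?I ?P4)"
  proof -
    have "?I ?P1 \<inter> ?I ?P2 = {}" "(?I ?P1 \<union> ?I ?P2) \<inter> ?I ?P3 = {}"
      "(?I ?P1 \<union> ?I ?P2 \<union> ?I ?P3) \<inter> ?I ?P4 = {}"
      using disjoint_pairs by blast+
    moreover have "finite (?I P)" if "finite P" for P :: "nat set set" using that by simp
    ultimately show ?thesis
      unfolding vertex_degree_def incident by (simp only: card_Un_disjoint finite_Un finite_pairs simp_thms)
  qed
  also have "card (?I ?P1) = of_bool (v + 1 < c) + of_bool (0 < v \<and> v < c)"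
  proof -
    have "v \<in> id ` {..<c - 1} \<longleftrightarrow> v + 1 < c" by auto
    moreover have "v \<in> Suc ` {..<c - 1} \<longleftrightarrow> 0 < v \<and> v < c" using c by (cases v) auto
    ultimately show ?thesis by (subst card_incident_pairs[OF inj_pairs(1)]) auto
  qed
  also have "card (?I ?P2) = l * (of_bool (v = 0) + of_bool (v + 1 = c))"
  proof -
    have "l = 0 \<or> l = 1" using l by linarith
    moreover have "0 \<noteq> c - 1" "v = c - 1 \<longleftrightarrow> v + 1 = c" using c by auto
    ultimately show ?thesis
      by (subst card_incident_pairs[OF inj_pairs(2)]) (auto simp: inj_on_def)
  qed
  also have "card (?I ?P3) = of_bool (v < k) + of_bool (s \<le> v \<and> v < k + s)"
  proof -
    have "v \<in> id ` {..<k} \<longleftrightarrow> v < k" by auto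
    moreover have "v \<in> (\<lambda>i. i + s) ` {..<k} \<longleftrightarrow> s \<le> v \<and> v < k + s"
      by (auto intro!: image_eqI[of _ _ "v - s"])
    ultimately show ?thesis
      using chord by (subst card_incident_pairs[OF inj_pairs(3)]) (auto simp: inj_on_def)
  qed
  also have "card (?I ?P4) = of_bool (0 < b \<and> v = q \<or> r < v \<and> v < r + b) + of_bool (c \<le> v \<and> v < c + b)"
  proof -
    have p: "v \<in> p ` {..<b} \<longleftrightarrow> 0 < b \<and> v = q \<or> r < v \<and> v < r + b"
    proof
      assume "0 < b \<and> v = q \<or> r < v \<and> v < r + b"
      then show "v \<in> p ` {..<b}"
        by (elim disjE) (auto intro!: image_eqI[of _ _ 0] image_eqI[of _ _ "v - r"])
    qed auto
    have tip: "v \<in> (\<lambda>j. c + j) ` {..<b} \<longleftrightarrow> c \<le> v \<and> v < c + b"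
      by (auto intro!: image_eqI[of _ _ "v - c"])
    have inj: "inj_on p {..<b}" "inj_on (\<lambda>j. c + j) {..<b}" using leaf by (auto simp: inj_on_def)
    have ne: "p j \<noteq> c + j" if "j < b" for j using leaf that by auto
    show ?thesis using card_incident_pairs[OF inj_pairs(4) inj ne, of v] unfolding p tip by simp
  qed
  finally show ?thesis by (simp only: add.assoc)
qed

lemma connected: "graph_connected G"
proof -
  let ?R = "adj_rel G"
  have step: "(v, Suc v) \<in> ?R" if "Suc v < c" for v
    using that by (auto simp: adj_rel_def spine_graph_def pairs_def)
  have path: "(0, v) \<in> ?R\<^sup>*" if "v < c" for v
    using that
  proof (induction v)
    case (Suc v)
    then show ?case using step[of v] by (meson Suc_lessD rtrancl.rtrancl_into_rtrancl)
  qed simp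
  have reach: "(0, v) \<in> ?R\<^sup>*" if v: "v < c + b" for v
  proof (cases "v < c")
    case True
    then show ?thesis by (rule path)
  next
    case False
    define j where "j = v - c"
    have j: "v = c + j" "j < b" using False v by (auto simp: j_def)
    have "p j < c" using leaf j by auto
    moreover have "{p j, v} \<in> edges G"
      using j unfolding spine_graph_def pairs_def ugraph.simps by blast
    then have "(p j, v) \<in> ?R" by (simp add: adj_rel_def)
    ultimately show ?thesis using path by (meson rtrancl.rtrancl_into_rtrancl)
  qed
  have "sym ?R" by (auto simp: sym_def adj_rel_def insert_commute)
  then have "(u, v) \<in> ?R\<^sup>*" if "u < c + b" "v < c + b" for u v
    using reach that by (meson rtrancl_trans symD sym_rtrancl)
  then show ?thesis using c by (simp add: graph_connected_def lessThan_empty_iff)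
qed

lemma chemical:
  assumes "7 \<le> c + b" "2 * (c - 1 + l + k + b) + 3 \<le> 3 * (c + b)"
    and deg: "\<And>v. v < c + b \<Longrightarrow> vertex_degree G v \<le> 3"
  shows "chemical_graph G"
proof -
  have "real (2 * graph_size G + 3) \<le> real (3 * graph_order G)"
    unfolding of_nat_le_iff size order by (fact assms)
  then have "real (graph_size G) \<le> (3 * real (graph_order G) - 3) / 2" by simp
  then show ?thesis
    using assms(1) deg simple connected by (simp add: chemical_graph_def order)
qed

end

section \<open>Attaining the bounds\<close>

lemma num_12_num_22_zeroI:
  assumes "\<And>e. e \<in> edges G \<Longrightarrow> \<exists>v\<in>e. vertex_degree G v = 3"
  shows "num_edges G 1 2 = 0" "num_edges G 2 2 = 0"
proof -
  have "edge_class G 1 2 = {}" "edge_class G 2 2 = {}"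
    using assms by (fastforce simp: edge_class_def)+
  then show "num_edges G 1 2 = 0" "num_edges G 2 2 = 0" by (simp_all add: num_edges_card_edge_class)
qed

text \<open>Every vertex of the spine should have degree \<open>3\<close>, except the two ends in the case of a
  tree and, for parity, at most one vertex of degree \<open>2\<close> whose neighbours have degree \<open>3\<close>.

  In a tree (a caterpillar) of odd order this exception is vertex \<open>2\<close>. In the other cases the first
  \<open>k = m - n\<close> vertices of a cycle are joined by chords to \<open>k + 1, \<dots>, 2 k\<close>, pendant vertices hang
  at \<open>k\<close> and at \<open>2 k + 1, \<dots>, 2 k + a - 1\<close>, and the exception, if any, is the last vertex
  \<open>2 k + a\<close>.\<close>

lemma Sigma_max_attained:
  assumes "7 \<le> n" "n \<le> m + 1" "2 * m + 3 \<le> 3 * n"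
  obtains G :: "nat ugraph" where "chemical_graph G" "graph_order G = n" "graph_size G = m"
    "num_edges G 1 2 = 0" "num_edges G 2 2 = 0"
proof (cases "n = m + 1")
  case True
  \<comment> \<open>\<open>t\<close> vertices of degree \<open>2\<close> and \<open>b\<close> pendant vertices besides the two ends of the path\<close>
  define t where "t = n mod 2"
  define b where "b = (n - 2 - t) div 2"
  have n: "n = 2 * b + 2 + t" and t: "t \<le> 1" and b: "2 \<le> b"
    using assms(1) unfolding b_def t_def by presburger+
  interpret spine "b + 2 + t" 0 0 2 1 "1 + t" b
    by unfold_locales (use b in auto)
  have deg: "vertex_degree G v \<le> 3" for v
    using b t unfolding degree by (auto simp: of_bool_def)
  have deg3: "vertex_degree G v = 3" if "0 < v" "v < b + t + 1" "t = 0 \<or> v \<noteq> 2" for v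
    using that b t unfolding degree by (auto simp: of_bool_def)
  have "\<exists>v\<in>e. vertex_degree G v = 3" if "e \<in> edges G" for e
    using that
  proof (cases rule: edge_cases)
    case (1 i)
    have "\<exists>v\<in>{i, Suc i}. 0 < v \<and> v < b + t + 1 \<and> (t = 0 \<or> v \<noteq> 2)"
      using 1 b t by auto
    then show ?thesis using deg3 1 by blast
  next
    case (4 j)
    have "vertex_degree G (p j) = 3" by (rule deg3) (use 4 b t in auto)
    then show ?thesis using 4 by blast
  qed auto
  note zero = num_12_num_22_zeroI[OF this]
  have "chemical_graph G" by (rule chemical) (use deg assms n b in auto)
  then show ?thesis by (rule that) (use order size zero n True in auto)
next
  case False
  define k where "k = m - n"
  define t where "t = n mod 2"
  \<comment> \<open>\<open>a\<close> pendant vertices; with \<open>2 k\<close> ends of chords and \<open>t\<close> vertices of degree \<open>2\<close> the cycle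
    has \<open>n - a\<close> vertices\<close>
  define a where "a = n div 2 - k"
  have k: "m = n + k" "2 * k + 3 \<le> n" using False assms unfolding k_def by linarith+
  have t: "n = 2 * (n div 2) + t" "t \<le> 1" unfolding t_def by simp_all
  then have a: "a + k = n div 2" "1 \<le> a" using k(2) unfolding a_def by linarith+
  then have n: "n = 2 * k + 2 * a + t" using t by linarith
  interpret spine "2 * k + a + t" 1 k "k + 1" k "2 * k" a
    by unfold_locales (use n a t assms k in auto)
  have deg: "vertex_degree G v \<le> 3" for v
    using a t unfolding degree by (auto simp: of_bool_def)
  have deg3: "vertex_degree G v = 3" if "v < 2 * k + a" for v
    using that a t unfolding degree by (auto simp: of_bool_def)
  have "\<exists>v\<in>e. vertex_degree G v = 3" if "e \<in> edges G" for e
    using that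
  proof (cases rule: edge_cases)
    case (1 i)
    then show ?thesis using deg3[of i] t by auto
  next
    case 2
    then show ?thesis using deg3[of 0] a by auto
  next
    case (3 i)
    then show ?thesis using deg3[of i] by auto
  next
    case (4 j)
    have "vertex_degree G (p j) = 3" by (rule deg3) (use 4 a in auto)
    then show ?thesis using 4 by blast
  qed
  note zero = num_12_num_22_zeroI[OF this]
  have "chemical_graph G" by (rule chemical) (use deg assms n k in auto)
  then show ?thesis by (rule that) (use order size zero n k a in auto)
qed

text \<open>A path, a cycle, and for \<open>m > n\<close> a cycle on which the ends of the \<open>k = m - n\<close> chords are
  consecutive, namely \<open>0, \<dots>, 2 k - 1\<close>: then only two edges join vertices of different degrees.
  A single chord cannot have consecutive ends; it joins \<open>0\<close> to \<open>2\<close>, and there are four such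
  edges.\<close>

lemma Sigma_min_attained:
  assumes "7 \<le> n" "n \<le> m + 1" "2 * m + 3 \<le> 3 * n"
  obtains G :: "nat ugraph" where "chemical_graph G" "graph_order G = n" "graph_size G = m"
    "num_edges G 1 2 + 4 * num_edges G 1 3 + num_edges G 2 3 \<le> Sigma_min n m"
proof -
  consider "n = m + 1" | "m = n" | "n < m" using assms(2) by linarith
  then show ?thesis
  proof cases
    case 1
    interpret spine n 0 0 2 0 0 0 by unfold_locales (use assms in auto)
    have deg: "vertex_degree G v \<le> 2" "vertex_degree G v = 1 \<Longrightarrow> v < n \<Longrightarrow> v = 0 \<or> v = n - 1" for v
      using assms unfolding degree by (auto simp: of_bool_def split: if_splits)
    have chem: "chemical_graph G" 
    proof (rule chemical)
      show "vertex_degree G v \<le> 3" for v using deg(1)[of v] by linarith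
    qed (use 1 assms in auto)
    have "degree_class G 1 \<subseteq> {0, n - 1}" using deg(2) by (auto simp: degree_class_def)
    then have "card (degree_class G 1) \<le> card {0, n - 1}" by (intro card_mono) auto
    also have "\<dots> \<le> 2" by (simp add: card_insert_if)
    finally have n1: "card (degree_class G 1) \<le> 2" .
    have "vertex_degree G v \<noteq> 3" for v using deg(1)[of v] by linarith
    then have "degree_class G 3 = {}" by (auto simp: degree_class_def)
    then have n3: "card (degree_class G 3) = 0" by simp
    have "num_edges G 1 2 + 4 * num_edges G 1 3 + num_edges G 2 3 \<le> Sigma_min n m"
      using n1 n3 chemical_linear_relations[OF chem] 1 unfolding Sigma_min_def by auto
    from chem _ _ this show ?thesis by (rule that) (use 1 order size in auto)
  next
    case 2
    interpret spine n 1 0 2 0 0 0 by unfold_locales (use assms in auto)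
    have deg: "vertex_degree G v = 2" if "v < n" for v
      using that assms unfolding degree by (auto simp: of_bool_def)
    have chem: "chemical_graph G" by (rule chemical) (use assms deg in auto)
    have "degree_class G 1 = {}" "degree_class G 3 = {}"
      using deg by (auto simp: degree_class_def)
    then have "num_edges G 1 2 + 4 * num_edges G 1 3 + num_edges G 2 3 \<le> Sigma_min n m"
      using chemical_linear_relations[OF chem] by auto
    from chem _ _ this show ?thesis by (rule that) (use 2 order size assms in auto)
  next
    case 3
    define k where "k = m - n"
    define s where "s = (if k = 1 then 2 else k)"
    have k: "m = n + k" "1 \<le> k" "2 * k + 3 \<le> n" using 3 assms unfolding k_def by linarith+
    have s: "2 \<le> s" "s + k < n" "k \<le> s" "s + 1 < n" using k assms(1) by (auto simp: s_def)
    interpret spine n 1 k s 0 0 0 by unfold_locales (use s assms in auto)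
    have deg: "vertex_degree G v = (if v < k \<or> s \<le> v \<and> v < k + s then 3 else 2)" if "v < n" for v
      using that s assms unfolding degree by (auto simp: of_bool_def)
    have chem: "chemical_graph G" by (rule chemical) (use assms deg k in auto)
    have "degree_class G 1 = {}" using deg by (auto simp: degree_class_def split: if_splits)
    then have x1: "num_edges G 1 2 = 0" "num_edges G 1 3 = 0"
      using chemical_linear_relations(1)[OF chem] by auto
    \<comment> \<open>the edges between vertices of different degrees\<close>
    let ?B = "if k = 1 then {{0, 1}, {1, 2}, {2, 3}, {0, n - 1}} else {{2 * k - 1, 2 * k}, {0, n - 1}}"
    have "edge_class G 2 3 \<subseteq> ?B"
    proof
      fix e assume e: "e \<in> edge_class G 2 3"
      then have "e \<in> edges G" by (simp add: edge_class_def)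
      then show "e \<in> ?B"
      proof (cases rule: edge_cases)
        case (1 i)
        then have "vertex_degree G i \<noteq> vertex_degree G (Suc i)"
          using e by (auto simp: doubleton_in_edge_class_iff)
        then have "(i < k \<or> s \<le> i \<and> i < k + s) \<noteq> (Suc i < k \<or> s \<le> Suc i \<and> Suc i < k + s)"
          using 1 deg by (auto split: if_splits)
        then have "if k = 1 then i = 0 \<or> i = 1 \<or> i = 2 else i = 2 * k - 1"
          using k(2) by (auto simp: s_def split: if_splits)
        then show ?thesis using 1 k(2) by (auto simp: numeral_2_eq_2 numeral_3_eq_3 split: if_splits)
      next
        case 2
        then show ?thesis by simp
      next
        case (3 i)
        then have "vertex_degree G i = 3" "vertex_degree G (i + s) = 3" using deg s by auto
        then show ?thesis using e 3 by (auto simp: doubleton_in_edge_class_iff)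
      qed simp
    qed
    then have "num_edges G 2 3 \<le> card ?B"
      unfolding num_edges_card_edge_class by (intro card_mono) auto
    also have "\<dots> \<le> Sigma_min n m"
      using k by (auto simp: Sigma_min_def card_insert_if)
    finally have "num_edges G 1 2 + 4 * num_edges G 1 3 + num_edges G 2 3 \<le> Sigma_min n m"
      using x1 by simp
    from chem _ _ this show ?thesis by (rule that) (use k order size assms in auto)
  qed
qed

section \<open>The extremal graphs\<close>

theorem corollary16:
  "{G :: 'a ugraph. extremal Sigma_index G} = F6 \<union> F7"
proof -
  let ?\<sigma> = "\<lambda>G :: 'a ugraph. num_edges G 1 2 + 4 * num_edges G 1 3 + num_edges G 2 3"
  have "extremal Sigma_index G \<longleftrightarrow> G \<in> F6 \<union> F7" if G: "chemical_graph G" for G :: "'a ugraph"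
  proof -
    let ?n = "graph_order G" and ?m = "graph_size G"
    let ?comp = "\<lambda>H :: 'a ugraph. chemical_graph H \<and> graph_order H = ?n \<and> graph_size H = ?m"
    note bounds = chemical_size_bounds[OF G]
    have n: "?n \<le> ?m + 1" using bounds(2) by simp
    have V: "?n = card (verts G)" by (simp add: graph_order_def)
    have "(\<forall>H. ?comp H \<longrightarrow> ?\<sigma> H \<le> ?\<sigma> G) \<longleftrightarrow> G \<in> F6"
    proof
      obtain H0 :: "nat ugraph" where H0: "chemical_graph H0" "graph_order H0 = ?n" "graph_size H0 = ?m"
        "num_edges H0 1 2 = 0" "num_edges H0 2 2 = 0"
        by (rule Sigma_max_attained[OF bounds(1) n bounds(3)])
      obtain H :: "'a ugraph" where H: "?comp H" "num_edges H 1 2 = 0" "num_edges H 2 2 = 0"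
        by (rule chemical_copy_exists[OF H0(1) trans[OF H0(2) V]]) (use H0 in auto)
      assume "\<forall>H. ?comp H \<longrightarrow> ?\<sigma> H \<le> ?\<sigma> G"
      then have "?\<sigma> H \<le> ?\<sigma> G" using H(1) by blast
      then have "num_edges G 1 2 = 0 \<and> num_edges G 2 2 = 0"
        using Sigma_complement[OF G] Sigma_complement[of H] H by linarith
      then show "G \<in> F6" using mem_F6_iff[OF G] by blast
    next
      assume "G \<in> F6"
      then have z: "num_edges G 1 2 = 0" "num_edges G 2 2 = 0" using mem_F6_iff[OF G] by blast+
      show "\<forall>H. ?comp H \<longrightarrow> ?\<sigma> H \<le> ?\<sigma> G"
      proof (intro allI impI)
        fix H assume "?comp H"
        then show "?\<sigma> H \<le> ?\<sigma> G"
          using Sigma_complement[OF G] Sigma_complement[of H] z by linarith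
      qed
    qed
    moreover have "(\<forall>H. ?comp H \<longrightarrow> ?\<sigma> G \<le> ?\<sigma> H) \<longleftrightarrow> G \<in> F7"
    proof
      obtain H0 :: "nat ugraph" where H0: "chemical_graph H0" "graph_order H0 = ?n" "graph_size H0 = ?m"
        "num_edges H0 1 2 + 4 * num_edges H0 1 3 + num_edges H0 2 3 \<le> Sigma_min ?n ?m"
        by (rule Sigma_min_attained[OF bounds(1) n bounds(3)])
      obtain H :: "'a ugraph" where H: "?comp H" "?\<sigma> H \<le> Sigma_min ?n ?m"
        by (rule chemical_copy_exists[OF H0(1) trans[OF H0(2) V]]) (use H0 in auto)
      assume "\<forall>H. ?comp H \<longrightarrow> ?\<sigma> G \<le> ?\<sigma> H"
      then have "?\<sigma> G \<le> Sigma_min ?n ?m" using H by (meson le_trans)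
      then show "G \<in> F7" using Sigma_min_characterization[OF G] by (meson le_antisym)
    next
      assume "G \<in> F7"
      then have eq: "?\<sigma> G = Sigma_min ?n ?m" using Sigma_min_characterization(2)[OF G] by blast
      show "\<forall>H. ?comp H \<longrightarrow> ?\<sigma> G \<le> ?\<sigma> H"
      proof (intro allI impI)
        fix H assume "?comp H"
        then show "?\<sigma> G \<le> ?\<sigma> H" using Sigma_min_characterization(1)[of H] eq by metis
      qed
    qed
    ultimately show ?thesis
      using G unfolding extremal_def Sigma_index_eq of_nat_le_iff Un_iff by blast
  qed
  moreover have "chemical_graph G" if "G \<in> F6 \<union> F7 \<or> extremal Sigma_index G" for G :: "'a ugraph"
    using that unfolding F6_def F7_def extremal_def by blast
  ultimately show ?thesis by blast
qed

end
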